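(* Let $I\subset[0,\infty)$ be an interval, let $a,b\in I$ with $a<b$, and let $f:I\to\mathbb{R}$ be differentiable on the interior $I^{\circ}$ of $I$ and at $a$ and $b$, with $f'\in L[a,b]$. Let $p>1$, $\frac1p+\frac1q=1$, and suppose that $|f'|^q$ is convex on $[a,b]$. Then for every division $d: a=x_0<x_1<\dots<x_{n-1}<x_n=b$ of $[a,b]$, the midpoint error $E(f,d)$ satisfies $$|E(f,d)|\le \frac{1}{4(p+1)^{1/p}}\sum_{i=0}^{n-1}(x_{i+1}-x_i)^2\left[|f'(x_{i+1})|+|f'(x_i)|\right].$$
   Context: For a division $d: a=x_0<x_1<\dots<x_n=b$, the midpoint sum is $T(f,d)=\sum_{i=0}^{n-1} f\left(\frac{x_i+x_{i+1}}{2}\right)(x_{i+1}-x_i)$ and the error is $E(f,d)=\int_a^b f(x)\,dx-T(f,d)$. $L[a,b]$ denotes the Lebesgue integrable functions on $[a,b]$. If $a$ or $b$ is an endpoint of $I$, differentiability there is one-sided (within $I$). *)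

theory Defs
  imports "HOL-Analysis.Analysis"
begin

definition is_division :: "real \<Rightarrow> real \<Rightarrow> nat \<Rightarrow> (nat \<Rightarrow> real) \<Rightarrow> bool" where
  "is_division a b n x \<longleftrightarrow> x 0 = a \<and> x n = b \<and> (\<forall>i<n. x i < x (Suc i))"

definition midpoint_sum :: "(real \<Rightarrow> real) \<Rightarrow> nat \<Rightarrow> (nat \<Rightarrow> real) \<Rightarrow> real" where
  "midpoint_sum f n x = (\<Sum>i<n. f ((x i + x (Suc i)) / 2) * (x (Suc i) - x i))"

text \<open>The integration bounds are the end points \<open>x 0\<close> and \<open>x n\<close> of the division.\<close>

definition midpoint_error :: "(real \<Rightarrow> real) \<Rightarrow> nat \<Rightarrow> (nat \<Rightarrow> real) \<Rightarrow> real" where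
  "midpoint_error f n x = integral {x 0..x n} f - midpoint_sum f n x"

end

theory Submission imports Defs begin

text \<open>
  Convexity of \<open>\<bar>f'\<bar>\<^sup>q\<close> is only used through the quasiconvexity of \<open>\<bar>f'\<bar>\<close>. A derivative has
  the intermediate value property, so two values of \<open>f'\<close> of opposite sign on \<open>(\<alpha>,\<beta>)\<close> enclose a
  zero \<open>c\<close>, and quasiconvexity on \<open>[\<alpha>,c]\<close> and \<open>[c,\<beta>]\<close> bounds them by \<open>\<bar>f'(\<alpha>)\<bar>\<close> and
  \<open>\<bar>f'(\<beta>)\<bar>\<close> respectively. Hence \<open>f'\<close> oscillates by at most \<open>K = \<bar>f'(\<alpha>)\<bar> + \<bar>f'(\<beta>)\<bar>\<close>, and the mean
  value theorem gives \<open>\<bar>f(m+u) + f(m-u) - 2 f(m)\<bar> \<le> K u\<close> at the midpoint \<open>m\<close>. Integrating over \<open>u\<close>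
  yields the error bound \<open>K (\<beta>-\<alpha>)\<^sup>2 / 8\<close> on each subinterval, and \<open>(p+1)\<^bsup>1/p\<^esup> \<le> 2\<close>.
\<close>

text \<open>Darboux's argument, since \<open>D\<close> may be discontinuous: \<open>f\<close>
  attains a minimum on the compact interval, the signs of \<open>D\<close> at \<open>s\<close> and
  \<open>t\<close> keep it away from both ends, and at an interior minimum the derivative
  vanishes.\<close>

lemma DERIV_zero_between_neg_pos:
  fixes f D :: "real \<Rightarrow> real"
  assumes "s < t" and D: "\<And>u. s \<le> u \<Longrightarrow> u \<le> t \<Longrightarrow> (f has_real_derivative D u) (at u)"
    and neg: "D s < 0" and pos: "0 < D t"
  obtains c where "s < c" "c < t" "D c = 0"
proof -
  have "continuous_on {s..t} f"
    by (intro continuous_at_imp_continuous_on ballI DERIV_isCont[OF D]) auto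
  then obtain c where c: "c \<in> {s..t}" and min: "\<And>u. u \<in> {s..t} \<Longrightarrow> f c \<le> f u"
    using continuous_attains_inf[of "{s..t}" f] \<open>s < t\<close> by auto
  have "c \<noteq> s"
  proof
    assume "c = s"
    obtain d where d: "d > 0" "\<And>h. 0 < h \<Longrightarrow> h < d \<Longrightarrow> f (s + h) < f s"
      using DERIV_neg_dec_right[OF D neg] \<open>s < t\<close> by auto
    \<comment> \<open>Halving \<open>d\<close> makes the step strictly smaller than
      \<open>d\<close>; the bound \<open>t - s\<close> keeps \<open>s + h\<close> in the
      interval.\<close>
    define h where "h = min (d / 2) (t - s)"
    have "0 < h" "h < d" "s + h \<in> {s..t}"
      using d(1) \<open>s < t\<close> by (auto simp: h_def min_def)
    with d(2)[of h] min[of "s + h"] \<open>c = s\<close> show False by simp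
  qed
  moreover have "c \<noteq> t"
  proof
    assume "c = t"
    obtain d where d: "d > 0" "\<And>h. 0 < h \<Longrightarrow> h < d \<Longrightarrow> f (t - h) < f t"
      using DERIV_pos_inc_left[OF D pos] \<open>s < t\<close> by auto
    define h where "h = min (d / 2) (t - s)"
    have "0 < h" "h < d" "t - h \<in> {s..t}"
      using d(1) \<open>s < t\<close> by (auto simp: h_def min_def)
    with d(2)[of h] min[of "t - h"] \<open>c = t\<close> show False by simp
  qed
  ultimately have "s < c" "c < t" using c by auto
  moreover have "D c = 0"
  proof (rule DERIV_local_min)
    show "(f has_real_derivative D c) (at c)" using D c by auto
    show "0 < min (c - s) (t - c)" using \<open>s < c\<close> \<open>c < t\<close> by auto
    show "\<forall>y. \<bar>c - y\<bar> < min (c - s) (t - c) \<longrightarrow> f c \<le> f y"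
      by (intro allI impI min) auto
  qed
  ultimately show thesis using that by blast
qed

lemma DERIV_zero_between_opposite_signs:
  fixes f D :: "real \<Rightarrow> real"
  assumes "s < t" and D: "\<And>u. s \<le> u \<Longrightarrow> u \<le> t \<Longrightarrow> (f has_real_derivative D u) (at u)"
    and "D s * D t < 0"
  obtains c where "s < c" "c < t" "D c = 0"
proof (cases "D s < 0")
  case True
  then have "0 < D t" using assms(3) by (auto simp: mult_less_0_iff)
  then show thesis using DERIV_zero_between_neg_pos[OF \<open>s < t\<close> D True] that by blast
next
  case False
  then have neg: "- D s < 0" and pos: "0 < - D t" using assms(3) by (auto simp: mult_less_0_iff)
  have "((\<lambda>x. - f x) has_real_derivative - D u) (at u)" if "s \<le> u" "u \<le> t" for u
    using D[OF that] by (rule DERIV_minus)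
  then show thesis
    using DERIV_zero_between_neg_pos[of s t "\<lambda>x. - f x" "\<lambda>x. - D x"] \<open>s < t\<close> neg pos that by auto
qed

text \<open>A convex function on an interval is bounded by its larger end value, and raising
  nonnegative numbers to a power \<open>q > 0\<close> is strictly increasing, so the bound passes
  from \<open>\<bar>D\<bar> powr q\<close> to \<open>\<bar>D\<bar>\<close>.\<close>

lemma convex_on_abs_powr_le_max:
  fixes D :: "real \<Rightarrow> real"
  assumes "convex_on {a..b} (\<lambda>t. \<bar>D t\<bar> powr q)" and "0 < q"
    and "a \<le> u" "u \<le> v" "v \<le> w" "w \<le> b"
  shows "\<bar>D v\<bar> \<le> max \<bar>D u\<bar> \<bar>D w\<bar>"
proof (rule ccontr)
  assume "\<not> ?thesis"
  then have "\<bar>D u\<bar> powr q < \<bar>D v\<bar> powr q" "\<bar>D w\<bar> powr q < \<bar>D v\<bar> powr q"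
    using \<open>0 < q\<close> by (auto intro!: powr_less_mono2)
  moreover have "convex_on {u..w} (\<lambda>t. \<bar>D t\<bar> powr q)"
    using assms by (intro convex_on_subset[OF assms(1)]) auto
  ultimately show False
    using convex_on_le_max[of u w _ v] \<open>u \<le> v\<close> \<open>v \<le> w\<close> by fastforce
qed

lemma DERIV_oscillation_bound:
  fixes f D :: "real \<Rightarrow> real"
  assumes D: "\<And>u. \<alpha> < u \<Longrightarrow> u < \<beta> \<Longrightarrow> (f has_real_derivative D u) (at u)"
    and qc: "\<And>u v w. \<alpha> \<le> u \<Longrightarrow> u \<le> v \<Longrightarrow> v \<le> w \<Longrightarrow> w \<le> \<beta> \<Longrightarrow> \<bar>D v\<bar> \<le> max \<bar>D u\<bar> \<bar>D w\<bar>"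
    and "\<alpha> < s" "s < t" "t < \<beta>"
  shows "\<bar>D t - D s\<bar> \<le> \<bar>D \<alpha>\<bar> + \<bar>D \<beta>\<bar>"
proof (cases "D s * D t < 0")
  case True
  have "(f has_real_derivative D u) (at u)" if "s \<le> u" "u \<le> t" for u
    using D[of u] that assms by simp
  then obtain c where "s < c" "c < t" "D c = 0"
    using DERIV_zero_between_opposite_signs[OF \<open>s < t\<close> _ True] by metis
  then show ?thesis using qc[of \<alpha> s c] qc[of c t \<beta>] assms by auto
next
  \<comment> \<open>Without opposite signs there is no cancellation to fear: the difference is at
    most the larger of the two absolute values, and each of these is bounded by quasiconvexity on
    all of [\<alpha>, \<beta>].\<close>
  case False
  have "\<bar>D s\<bar> \<le> max \<bar>D \<alpha>\<bar> \<bar>D \<beta>\<bar>" "\<bar>D t\<bar> \<le> max \<bar>D \<alpha>\<bar> \<bar>D \<beta>\<bar>"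
    using qc[of \<alpha> s \<beta>] qc[of \<alpha> t \<beta>] assms by auto
  moreover have "\<bar>D t - D s\<bar> \<le> max \<bar>D s\<bar> \<bar>D t\<bar>"
    using False by (auto simp: mult_less_0_iff)
  ultimately show ?thesis by linarith
qed

lemma midpoint_second_difference_bound:
  fixes f D :: "real \<Rightarrow> real"
  assumes cont: "continuous_on {m - r..m + r} f"
    and D: "\<And>u. m - r < u \<Longrightarrow> u < m + r \<Longrightarrow> (f has_real_derivative D u) (at u)"
    and osc: "\<And>v. 0 < v \<Longrightarrow> v < r \<Longrightarrow> \<bar>D (m + v) - D (m - v)\<bar> \<le> K"
    and "0 \<le> u" "u \<le> r"
  shows "\<bar>f (m + u) + f (m - u) - 2 * f m\<bar> \<le> K * u"
proof (cases "u = 0")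
  case False
  \<comment> \<open>The symmetric sum has \<open>g 0 = 2 * f m\<close>, and its derivative is the
    difference bounded by \<open>osc\<close>. The mean value theorem uses derivatives in the open
    interval only, so \<open>u = r\<close> is covered as well.\<close>
  define g where "g v = f (m + v) + f (m - v)" for v
  have "continuous_on {0..u} g"
    unfolding g_def using \<open>u \<le> r\<close>
    by (intro continuous_intros continuous_on_compose2[OF cont]) auto
  moreover have "(g has_real_derivative D (m + v) - D (m - v)) (at v)" if "0 < v" "v < u" for v
  proof -
    have "(f has_real_derivative D (m + v)) (at (m + v))" "(f has_real_derivative D (m - v)) (at (m - v))"
      using that \<open>u \<le> r\<close> by (auto intro!: D)
    moreover have "((\<lambda>v. m + v) has_real_derivative 1) (at v)" "((\<lambda>v. m - v) has_real_derivative - 1) (at v)"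
      by (auto intro!: derivative_eq_intros)
    ultimately have "((\<lambda>v. f (m + v) + f (m - v)) has_real_derivative
        D (m + v) * 1 + D (m - v) * - 1) (at v)"
      by (intro DERIV_add DERIV_chain2[of f])
    then show ?thesis by (simp add: g_def[abs_def])
  qed
  ultimately obtain v where v: "0 < v" "v < u" and "g u - g 0 = (D (m + v) - D (m - v)) * (u - 0)"
    using mvt[of 0 u g "\<lambda>v. (*) (D (m + v) - D (m - v))"] \<open>0 \<le> u\<close> False
    by (auto simp: has_field_derivative_def)
  then have "\<bar>f (m + u) + f (m - u) - 2 * f m\<bar> = u * \<bar>D (m + v) - D (m - v)\<bar>"
    using \<open>0 \<le> u\<close> by (simp add: g_def abs_mult)
  also have "\<dots> \<le> u * K"
    using osc[of v] v assms by (intro mult_left_mono) auto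
  finally show ?thesis by (simp add: mult.commute)
qed simp

text \<open>Folding the interval at \<open>m\<close> turns the error into the integral over [0, r]
  of the second difference \<open>f (m + u) + f (m - u) - 2 * f m\<close>; the right-hand side is
  the integral of \<open>K * u\<close>.\<close>

lemma midpoint_rule_error_bound:
  fixes f :: "real \<Rightarrow> real"
  assumes cont: "continuous_on {m - r..m + r} f" and "0 \<le> r"
    and bound: "\<And>u. 0 \<le> u \<Longrightarrow> u \<le> r \<Longrightarrow> \<bar>f (m + u) + f (m - u) - 2 * f m\<bar> \<le> K * u"
  shows "\<bar>integral {m - r..m + r} f - f m * (2 * r)\<bar> \<le> K * r\<^sup>2 / 2"
proof -
  have int: "f integrable_on {m - r..m + r}"
    using cont by (rule integrable_continuous_interval)
  then have "f integrable_on {m - r..m}" "f integrable_on {m..m + r}"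
    using \<open>0 \<le> r\<close> by (auto elim!: integrable_subinterval_real)
  then have l: "(f has_integral integral {m - r..m} f) {m - r..m}"
    and r: "(f has_integral integral {m..m + r} f) {m..m + r}"
    by (auto simp: integrable_integral)
  have r': "((\<lambda>u. f (m + u)) has_integral integral {m..m + r} f) {0..r}"
    using r has_integral_shift_Icc_real[of f m _ 0 r] by (simp add: o_def add.commute)
  \<comment> \<open>The left half is first shifted to [-r, 0] and then reflected onto
    [0, r].\<close>
  have "((\<lambda>u. f (m + u)) has_integral integral {m - r..m} f) {- r..- 0}"
    using l has_integral_shift_Icc_real[of f m _ "- r" 0] by (simp add: o_def)
  then have l': "((\<lambda>u. f (m - u)) has_integral integral {m - r..m} f) {0..r}"
    by (subst (asm) has_integral_reflect_real[symmetric]) simp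
  have "((\<lambda>u. 2 * f m) has_integral 2 * f m * r) {0..r}"
    using has_integral_const_real[of "2 * f m" 0 r] \<open>0 \<le> r\<close> by (simp add: mult.commute)
  note h = has_integral_diff[OF has_integral_add[OF r' l'] this]
  have k: "((\<lambda>u. K * u) has_integral K * (r\<^sup>2 / 2)) {0..r}"
    using ident_has_integral[OF \<open>0 \<le> r\<close>] by (intro has_integral_mult_right) simp
  have "norm (integral {0..r} (\<lambda>u. f (m + u) + f (m - u) - 2 * f m)) \<le> integral {0..r} (\<lambda>u. K * u)"
    using h k bound by (intro integral_norm_bound_integral) (auto simp: integrable_on_def)
  then have "\<bar>integral {m..m + r} f + integral {m - r..m} f - 2 * f m * r\<bar> \<le> K * (r\<^sup>2 / 2)"
    unfolding integral_unique[OF h] integral_unique[OF k] real_norm_def .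
  moreover have "integral {m - r..m} f + integral {m..m + r} f = integral {m - r..m + r} f"
    using \<open>0 \<le> r\<close> int by (intro Henstock_Kurzweil_Integration.integral_combine) auto
  ultimately show ?thesis by (simp add: algebra_simps)
qed

lemma midpoint_rule_error_bound_quasiconvex:
  fixes f D :: "real \<Rightarrow> real"
  assumes "\<alpha> < \<beta>" and cont: "continuous_on {\<alpha>..\<beta>} f"
    and D: "\<And>u. \<alpha> < u \<Longrightarrow> u < \<beta> \<Longrightarrow> (f has_real_derivative D u) (at u)"
    and qc: "\<And>u v w. \<alpha> \<le> u \<Longrightarrow> u \<le> v \<Longrightarrow> v \<le> w \<Longrightarrow> w \<le> \<beta> \<Longrightarrow> \<bar>D v\<bar> \<le> max \<bar>D u\<bar> \<bar>D w\<bar>"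
  shows "\<bar>integral {\<alpha>..\<beta>} f - f ((\<alpha> + \<beta>) / 2) * (\<beta> - \<alpha>)\<bar> \<le> (\<beta> - \<alpha>)\<^sup>2 * (\<bar>D \<beta>\<bar> + \<bar>D \<alpha>\<bar>) / 8"
proof -
  define m r where "m = (\<alpha> + \<beta>) / 2" and "r = (\<beta> - \<alpha>) / 2"
  have mr: "m - r = \<alpha>" "m + r = \<beta>" "2 * r = \<beta> - \<alpha>" "0 \<le> r"
    using \<open>\<alpha> < \<beta>\<close> by (auto simp: m_def r_def field_simps)
  have "\<bar>D (m + v) - D (m - v)\<bar> \<le> \<bar>D \<alpha>\<bar> + \<bar>D \<beta>\<bar>" if "0 < v" "v < r" for v
    using that mr by (intro DERIV_oscillation_bound[of \<alpha> \<beta> f D] D qc) auto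
  then have "\<bar>f (m + u) + f (m - u) - 2 * f m\<bar> \<le> (\<bar>D \<alpha>\<bar> + \<bar>D \<beta>\<bar>) * u" if "0 \<le> u" "u \<le> r" for u
    using that cont D by (intro midpoint_second_difference_bound[of m r f D]) (auto simp: mr)
  then have "\<bar>integral {\<alpha>..\<beta>} f - f m * (\<beta> - \<alpha>)\<bar> \<le> (\<bar>D \<alpha>\<bar> + \<bar>D \<beta>\<bar>) * r\<^sup>2 / 2"
    using midpoint_rule_error_bound[of m r f "\<bar>D \<alpha>\<bar> + \<bar>D \<beta>\<bar>"] cont mr by simp
  also have "\<dots> = (\<beta> - \<alpha>)\<^sup>2 * (\<bar>D \<beta>\<bar> + \<bar>D \<alpha>\<bar>) / 8"
    by (simp add: r_def power_divide field_simps)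
  finally show ?thesis by (simp add: m_def)
qed

lemma is_division_le:
  assumes "is_division a b n x" and "i \<le> j" and "j \<le> n"
  shows "x i \<le> x j"
  using assms(2,3)
proof (induction j rule: dec_induct)
  case (step k)
  then have "x i \<le> x k" "x k < x (Suc k)" using assms(1) by (auto simp: is_division_def)
  then show ?case by linarith
qed simp

text \<open>Stated for every prefix \<open>k \<le> n\<close>, so that the induction keeps the
  division and the integrability on [a, b] fixed.\<close>

lemma integral_division:
  fixes f :: "real \<Rightarrow> real"
  assumes "is_division a b n x" and "f integrable_on {a..b}" and "k \<le> n"
  shows "integral {x 0..x k} f = (\<Sum>i<k. integral {x i..x (Suc i)} f)"
  using assms(3)
proof (induction k)
  case (Suc k)
  have le: "x 0 \<le> x k" "x k \<le> x (Suc k)" "x (Suc k) \<le> x n"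
    using Suc.prems by (auto intro: is_division_le[OF assms(1)])
  then have "f integrable_on {x 0..x (Suc k)}"
    using assms(1,2) by (auto simp: is_division_def elim!: integrable_subinterval_real)
  then have "integral {x 0..x k} f + integral {x k..x (Suc k)} f = integral {x 0..x (Suc k)} f"
    using le by (intro Henstock_Kurzweil_Integration.integral_combine) auto
  with Suc show ?case by simp
qed simp

text \<open>Equivalent to \<open>p + 1 \<le> 2 powr p\<close>, with equality at
  \<open>p = 1\<close>. Since ln 2 \<ge> 1/2, the bound exp y \<ge> 1 + y at y = (p - 1) ln 2 gives
  2^(p-1) \<ge> 1 + (p - 1)/2 = (p + 1)/2.\<close>

lemma plus_one_powr_inverse_le_two:
  fixes p :: real
  assumes "1 \<le> p"
  shows "(p + 1) powr (1 / p) \<le> 2"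
proof -
  have "ln (1 / 2 :: real) \<le> 1 / 2 - 1"
    by (rule ln_le_minus_one) simp
  then have "(1 / 2) * (p - 1) \<le> ln 2 * (p - 1)"
    using assms by (intro mult_right_mono) (auto simp: ln_div)
  also have "\<dots> \<le> exp (ln 2 * (p - 1)) - 1"
    using exp_ge_add_one_self[of "ln 2 * (p - 1)"] by linarith
  also have "exp (ln 2 * (p - 1)) = 2 powr p / 2"
    by (simp add: powr_def right_diff_distrib exp_diff mult.commute[of p])
  finally have "p + 1 \<le> 2 powr p" by (simp add: field_simps)
  then have "(p + 1) powr (1 / p) \<le> (2 powr p) powr (1 / p)"
    using assms by (intro powr_mono2) auto
  also have "\<dots> = 2" using assms by (simp add: powr_powr)
  finally show ?thesis .
qed

theorem proposition4:
  fixes I :: "real set" and a b p q :: real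
    and f f' :: "real \<Rightarrow> real" and n :: nat and x :: "nat \<Rightarrow> real"
  assumes "is_interval I" and "I \<subseteq> {0..}"
    and "a \<in> I" and "b \<in> I" and "a < b"
    and "\<And>t. t \<in> interior I \<union> {a, b} \<Longrightarrow> (f has_real_derivative f' t) (at t within I)"
    and "f' absolutely_integrable_on {a..b}"
    and "p > 1" and "1 / p + 1 / q = 1"
    and "convex_on {a..b} (\<lambda>t. \<bar>f' t\<bar> powr q)"
    and "is_division a b n x"
  shows "\<bar>midpoint_error f n x\<bar>
    \<le> 1 / (4 * (p + 1) powr (1 / p))
      * (\<Sum>i<n. (x (Suc i) - x i)\<^sup>2 * (\<bar>f' (x (Suc i))\<bar> + \<bar>f' (x i)\<bar>))"
proof -
  have "1 / p < 1" using \<open>p > 1\<close> by simp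
  \<comment> \<open>Strict positivity of \<open>1 / q\<close> also excludes \<open>q = 0\<close>,
    for which \<open>1 / q\<close> would be 0.\<close>
  then have "0 < 1 / q" using \<open>1 / p + 1 / q = 1\<close> by linarith
  then have "0 < q" by simp
  have sub: "{a..b} \<subseteq> I"
    using mem_is_interval_1_I[OF assms(1,3,4)] by auto
  then have inner: "{a<..<b} \<subseteq> interior I"
    by (intro interior_maximal) auto
  have D: "(f has_real_derivative f' t) (at t)" if "a < t" "t < b" for t
  proof -
    have t: "t \<in> interior I" using inner that by auto
    from assms(6)[OF UnI1[OF this]] show ?thesis
      unfolding at_within_interior[OF t] .
  qed
  \<comment> \<open>Restricting derivatives within \<open>I\<close> to [a, b] treats interior points
    and the possibly one-sided end points alike, which gives continuity up to \<open>a\<close> and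
    \<open>b\<close>.\<close>
  have "(f has_real_derivative f' t) (at t within {a..b})" if "t \<in> {a..b}" for t
  proof -
    have "t \<in> {a<..<b} \<union> {a, b}" using that by auto
    then have "t \<in> interior I \<union> {a, b}" using inner by blast
    from DERIV_subset[OF assms(6)[OF this] sub] show ?thesis .
  qed
  then have cont: "continuous_on {a..b} f"
    by (rule DERIV_continuous_on)
  have "\<bar>midpoint_error f n x\<bar>
      = \<bar>\<Sum>i<n. integral {x i..x (Suc i)} f - f ((x i + x (Suc i)) / 2) * (x (Suc i) - x i)\<bar>"
    using integral_division[OF assms(11) integrable_continuous_interval[OF cont] order_refl]
    by (simp add: midpoint_error_def midpoint_sum_def sum_subtractf)
  also have "\<dots> \<le> (\<Sum>i<n. (x (Suc i) - x i)\<^sup>2 * (\<bar>f' (x (Suc i))\<bar> + \<bar>f' (x i)\<bar>) / 8)"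
  proof (rule order_trans[OF sum_abs], rule sum_mono)
    fix i assume "i \<in> {..<n}"
    then have i: "x i < x (Suc i)" "a \<le> x i" "x (Suc i) \<le> b"
      using assms(11) is_division_le[OF assms(11), of 0 i] is_division_le[OF assms(11), of "Suc i" n]
      by (auto simp: is_division_def)
    show "\<bar>integral {x i..x (Suc i)} f - f ((x i + x (Suc i)) / 2) * (x (Suc i) - x i)\<bar>
        \<le> (x (Suc i) - x i)\<^sup>2 * (\<bar>f' (x (Suc i))\<bar> + \<bar>f' (x i)\<bar>) / 8"
      \<comment> \<open>Points strictly inside a subinterval lie strictly between \<open>a\<close>
        and \<open>b\<close>, where \<open>D\<close> supplies two-sided derivatives.\<close>
      using i
      by (intro midpoint_rule_error_bound_quasiconvex D continuous_on_subset[OF cont]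
          convex_on_abs_powr_le_max[OF assms(10) \<open>0 < q\<close>]) auto
  qed
  also have "\<dots> = 1 / 8 * (\<Sum>i<n. (x (Suc i) - x i)\<^sup>2 * (\<bar>f' (x (Suc i))\<bar> + \<bar>f' (x i)\<bar>))"
    by (simp add: sum_divide_distrib)
  \<comment> \<open>Here \<open>4 * (p + 1) powr (1 / p) \<le> 8\<close>, and the sum is
    nonnegative.\<close>
  also have "\<dots> \<le> 1 / (4 * (p + 1) powr (1 / p))
      * (\<Sum>i<n. (x (Suc i) - x i)\<^sup>2 * (\<bar>f' (x (Suc i))\<bar> + \<bar>f' (x i)\<bar>))"
    using plus_one_powr_inverse_le_two[of p] \<open>p > 1\<close>
    by (intro mult_right_mono sum_nonneg divide_left_mono) auto
  finally show ?thesis .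
qed

end
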